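(* Let $(\mathcal{A},\varepsilon)$ be a full-dimensional signed support in $\mathbb{R}^n$ with Gale dual matrix $B$ such that $\#\mathcal{A}_-=1$. Then: (i) for all $c\in\mathbb{R}^{\mathcal{A}}_\varepsilon$ and $x\in\operatorname{Sing}(f_c)$ the Hessian matrix $\operatorname{Hess}_{f_c}(x)$ has only positive eigenvalues; (ii) if $(\mathcal{A},\varepsilon)$ has codimension $2$, then the complement $\mathbb{R}^2\setminus\Gamma_\varepsilon(A,B)$ of the signed reduced $A$-discriminant consists of at most two connected components.
   Context: A signed support $(\mathcal{A},\varepsilon)$ in $\mathbb{R}^n$ consists of a finite set $\mathcal{A}=\{\alpha_1,\dots,\alpha_{n+k+1}\}\subseteq\mathbb{R}^n$ of (distinct) exponent vectors and a sign distribution $\varepsilon\in\{\pm1\}^{n+k+1}$; it is full-dimensional if $\dim\operatorname{Conv}(\mathcal{A})=n$. Put $\mathcal{A}_+=\{\alpha_i:\varepsilon_i=1\}$, $\mathcal{A}_-=\{\alpha_i:\varepsilon_i=-1\}$ and $\mathbb{R}^{\mathcal{A}}_\varepsilon=\{c\in\mathbb{R}^{n+k+1}:\operatorname{sign}(c)=\varepsilon\}$. For $c\in\mathbb{R}^{\mathcal{A}}_\varepsilon$ let $f_c(x)=\sum_i c_i e^{\alpha_i\cdot x}$ on $\mathbb{R}^n$, and let $\operatorname{Sing}(f_c)$ be the set of $x\in\mathbb{R}^n$ at which $f_c$ and all its first partial derivatives vanish. Let $\nabla_{\mathcal{A},\varepsilon}=\{c\in\mathbb{R}^{\mathcal{A}}_\varepsilon:\operatorname{Sing}(f_c)\ne\emptyset\}$.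 Let $\hat A\in\mathbb{R}^{(n+1)\times(n+k+1)}$ have $i$-th column $(1,\alpha_i)^\top$. The codimension of $\mathcal{A}$ is $\dim\ker(\hat A)$ (equal to $k$ in the full-dimensional case). A Gale dual matrix $B$ of $\mathcal{A}$ is a matrix in $\mathbb{R}^{(n+k+1)\times k}$ whose columns form a basis of $\ker(\hat A)$. The signed reduced $A$-discriminant is $\Gamma_\varepsilon(A,B)=\{B^\top\operatorname{Log}|c|:c\in\nabla_{\mathcal{A},\varepsilon}\}\subseteq\mathbb{R}^k$ (coordinate-wise absolute value and natural logarithm). *)

theory Defs
  imports "HOL-Analysis.Analysis"
begin

text \<open>
  A support is a family \<open>\<alpha> :: 'm \<Rightarrow> real ^ 'n\<close> of exponent vectors indexed by a finite type with
  \<open>CARD('m) = n + k + 1\<close> elements; coefficient and sign vectors live in \<open>real ^ 'm\<close>.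
\<close>

definition signed_support :: "('m::finite \<Rightarrow> real ^ 'n) \<Rightarrow> real ^ 'm \<Rightarrow> bool" where
  "signed_support \<alpha> \<epsilon> \<longleftrightarrow> inj \<alpha> \<and> (\<forall>i. \<epsilon> $ i \<in> {1, -1})"

definition full_dimensional :: "('m::finite \<Rightarrow> real ^ 'n) \<Rightarrow> bool" where
  "full_dimensional \<alpha> \<longleftrightarrow> aff_dim (convex hull range \<alpha>) = int CARD('n)"

definition neg_support :: "('m::finite \<Rightarrow> real ^ 'n) \<Rightarrow> real ^ 'm \<Rightarrow> (real ^ 'n) set" where
  "neg_support \<alpha> \<epsilon> = {\<alpha> i |i. \<epsilon> $ i = -1}"

definition sign_orthant :: "real ^ 'm \<Rightarrow> (real ^ 'm) set" where
  "sign_orthant \<epsilon> = {c. \<forall>i. sgn (c $ i) = \<epsilon> $ i}"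

definition exp_sum :: "('m::finite \<Rightarrow> real ^ 'n) \<Rightarrow> real ^ 'm \<Rightarrow> real ^ 'n \<Rightarrow> real" where
  "exp_sum \<alpha> c x = (\<Sum>i\<in>UNIV. c $ i * exp (\<alpha> i \<bullet> x))"

definition partial_deriv :: "'n \<Rightarrow> (real ^ 'n \<Rightarrow> real) \<Rightarrow> real ^ 'n \<Rightarrow> real" where
  "partial_deriv j f x = deriv (\<lambda>t. f (x + t *\<^sub>R axis j 1)) 0"

definition hessian :: "(real ^ 'n \<Rightarrow> real) \<Rightarrow> real ^ 'n \<Rightarrow> real ^ 'n ^ 'n" where
  "hessian f x = (\<chi> i j. partial_deriv i (partial_deriv j f) x)"

definition eigenvalue :: "real ^ 'n ^ 'n \<Rightarrow> real \<Rightarrow> bool" where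
  "eigenvalue M \<mu> \<longleftrightarrow> (\<exists>v. v \<noteq> 0 \<and> M *v v = \<mu> *\<^sub>R v)"

definition Sing :: "(real ^ 'n \<Rightarrow> real) \<Rightarrow> (real ^ 'n) set" where
  "Sing f = {x. f x = 0 \<and> (\<forall>j. partial_deriv j f x = 0)}"

definition signed_discriminant :: "('m::finite \<Rightarrow> real ^ 'n) \<Rightarrow> real ^ 'm \<Rightarrow> (real ^ 'm) set" where
  "signed_discriminant \<alpha> \<epsilon> = {c \<in> sign_orthant \<epsilon>. Sing (exp_sum \<alpha> c) \<noteq> {}}"

text \<open>The row index \<open>None\<close> is the row of ones, so that column \<open>i\<close> is \<open>(1, \<alpha> i)\<close>.\<close>

definition A_hat :: "('m::finite \<Rightarrow> real ^ 'n) \<Rightarrow> real ^ 'm ^ 'n option" where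
  "A_hat \<alpha> = (\<chi> r i. case r of None \<Rightarrow> 1 | Some j \<Rightarrow> \<alpha> i $ j)"

definition ker_A_hat :: "('m::finite \<Rightarrow> real ^ 'n) \<Rightarrow> (real ^ 'm) set" where
  "ker_A_hat \<alpha> = {v. A_hat \<alpha> *v v = 0}"

definition codimension :: "('m::finite \<Rightarrow> real ^ 'n) \<Rightarrow> nat" where
  "codimension \<alpha> = dim (ker_A_hat \<alpha>)"

text \<open>Since \<^const>\<open>columns\<close> is a set, injectivity is needed to exclude repeated columns.\<close>

definition gale_dual :: "('m::finite \<Rightarrow> real ^ 'n) \<Rightarrow> real ^ 'k ^ 'm \<Rightarrow> bool" where
  "gale_dual \<alpha> B \<longleftrightarrow>
     inj (\<lambda>j. column j B) \<and> independent (columns B) \<and> span (columns B) = ker_A_hat \<alpha>"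

definition Log_abs :: "real ^ 'm \<Rightarrow> real ^ 'm" where
  "Log_abs c = (\<chi> i. ln \<bar>c $ i\<bar>)"

definition signed_reduced_discriminant ::
    "('m::finite \<Rightarrow> real ^ 'n) \<Rightarrow> real ^ 'm \<Rightarrow> real ^ 'k ^ 'm \<Rightarrow> (real ^ 'k) set" where
  "signed_reduced_discriminant \<alpha> \<epsilon> B =
     {transpose B *v Log_abs c |c. c \<in> signed_discriminant \<alpha> \<epsilon>}"

end

theory Submission
  imports Defs
begin

text \<open>
  Let \<open>p\<close> be the index of the only negative coefficient. Dividing \<open>f\<^sub>c\<close> by \<open>exp (\<alpha> p \<bullet> x)\<close>
  does not move its singular points and turns it into a convex function minus a constant:
  \[ \sum_{i \neq p} c_i e^{(\alpha_i - \alpha_p) \cdot x} - |c_p| . \]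
  A singular point is thus a global minimum with value \<open>0\<close>.

  For the Hessian, put \<open>w i = c $ i * exp (\<alpha> i \<bullet> x)\<close> at a singular point \<open>x\<close>. The equations of
  \<open>Sing\<close> say that both \<open>w\<close> and \<open>w i *\<^sub>R \<alpha> i\<close> sum to zero, so the quadratic form
  \<open>\<Sum> w i * (\<alpha> i \<bullet> v)\<^sup>2\<close> of the Hessian does not change when every \<open>\<alpha> i\<close> is replaced by
  \<open>\<alpha> i - \<alpha> p\<close>. This removes the negative term. The remaining sum of nonnegative terms
  vanishes only if \<open>v\<close> is orthogonal to all differences, that is, by full dimension, if
  \<open>v = 0\<close> (\<open>hessian_positive_definite_at_Sing\<close>).

  For the discriminant, convexity gives a dichotomy (\<open>Sing_empty_iff\<close>): \<open>f\<^sub>c\<close> has no singular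
  point iff it is negative somewhere or positive everywhere. In the logarithmic coordinates
  \<open>u = Log |c|\<close> both conditions define connected sets. The first one, after division by the
  negative term, asks for a point \<open>x\<close> at which a function that is jointly convex in \<open>(u, x)\<close> is
  less than \<open>1\<close>; its solution set is a projection of a convex set. The second one is preserved
  when positive coefficients grow and the negative one shrinks in absolute value, so any two
  of its solutions can be joined through a common larger solution.

  Finally, the fibres of \<open>B\<^sup>T\<close> are the cosets of the row space of the matrix \<open>A_hat \<alpha>\<close>,
  and moving \<open>u\<close> along this row space only multiplies \<open>f\<^sub>c\<close> by a positive constant and translates
  it. Hence the complement of the reduced discriminant is the image under \<open>B\<^sup>T\<close> of the set of
  those \<open>u\<close> without singular points, a union of two connected sets.
\<close>

section \<open>Derivatives of exponential sums\<close>

lemma exp_sum_line_has_derivative: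
  "((\<lambda>t. exp_sum \<alpha> c (x + t *\<^sub>R axis j 1)) has_real_derivative
     exp_sum \<alpha> (\<chi> i. c $ i * \<alpha> i $ j) x) (at 0)"
  unfolding exp_sum_def
  by (auto intro!: derivative_eq_intros simp: inner_axis inner_add_right mult_ac)

lemma partial_deriv_exp_sum:
  "partial_deriv j (exp_sum \<alpha> c) = exp_sum \<alpha> (\<chi> i. c $ i * \<alpha> i $ j)"
  by (rule ext) (simp add: partial_deriv_def DERIV_imp_deriv[OF exp_sum_line_has_derivative])

lemma Sing_exp_sum_iff:
  "x \<in> Sing (exp_sum \<alpha> c) \<longleftrightarrow>
     exp_sum \<alpha> c x = 0 \<and> (\<Sum>i\<in>UNIV. (c $ i * exp (\<alpha> i \<bullet> x)) *\<^sub>R \<alpha> i) = 0"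
  by (auto simp: Sing_def partial_deriv_exp_sum exp_sum_def vec_eq_iff mult_ac)

lemma hessian_exp_sum_quadratic_form:
  "v \<bullet> (hessian (exp_sum \<alpha> c) x *v v) =
     (\<Sum>i\<in>UNIV. c $ i * exp (\<alpha> i \<bullet> x) * (\<alpha> i \<bullet> v)\<^sup>2)"
proof -
  have "v \<bullet> (hessian (exp_sum \<alpha> c) x *v v) =
      (\<Sum>j\<in>UNIV. \<Sum>k\<in>UNIV. \<Sum>i\<in>UNIV.
        c $ i * exp (\<alpha> i \<bullet> x) * ((\<alpha> i $ j * v $ j) * (\<alpha> i $ k * v $ k)))"
    unfolding hessian_def partial_deriv_exp_sum
    by (simp add: inner_vec_def matrix_vector_mult_def exp_sum_def sum_distrib_left
        sum_distrib_right mult_ac)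
  also have "\<dots> = (\<Sum>j\<in>UNIV. \<Sum>i\<in>UNIV. \<Sum>k\<in>UNIV.
        c $ i * exp (\<alpha> i \<bullet> x) * ((\<alpha> i $ j * v $ j) * (\<alpha> i $ k * v $ k)))"
    by (intro sum.cong refl sum.swap)
  also have "\<dots> = (\<Sum>i\<in>UNIV. \<Sum>j\<in>UNIV. \<Sum>k\<in>UNIV.
        c $ i * exp (\<alpha> i \<bullet> x) * ((\<alpha> i $ j * v $ j) * (\<alpha> i $ k * v $ k)))"
    by (rule sum.swap)
  also have "\<dots> = (\<Sum>i\<in>UNIV. c $ i * exp (\<alpha> i \<bullet> x) * (\<alpha> i \<bullet> v)\<^sup>2)"
  proof (rule sum.cong[OF refl])
    fix i
    have "(\<alpha> i \<bullet> v)\<^sup>2 = (\<Sum>j\<in>UNIV. \<Sum>k\<in>UNIV. (\<alpha> i $ j * v $ j) * (\<alpha> i $ k * v $ k))"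
      by (simp add: inner_vec_def power2_eq_square sum_product)
    then show "(\<Sum>j\<in>UNIV. \<Sum>k\<in>UNIV.
        c $ i * exp (\<alpha> i \<bullet> x) * ((\<alpha> i $ j * v $ j) * (\<alpha> i $ k * v $ k))) =
        c $ i * exp (\<alpha> i \<bullet> x) * (\<alpha> i \<bullet> v)\<^sup>2"
      by (simp only: sum_distrib_left)
  qed
  finally show ?thesis .
qed

section \<open>Singular points when there is a single negative coefficient\<close>

text \<open>
  Subtracting \<open>\<alpha> p\<close> from the exponents is harmless at a singular point because there the weights
  \<open>c $ i * exp (\<alpha> i \<bullet> x)\<close> sum to zero. For \<open>p\<close> the negative index, the only term with a
  negative weight disappears.
\<close>

lemma Sing_weighted_diff_sum_zero:
  assumes "x \<in> Sing (exp_sum \<alpha> c)"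
  shows "(\<Sum>i\<in>UNIV. c $ i * exp (\<alpha> i \<bullet> x) * ((\<alpha> i - \<alpha> p) \<bullet> v)) = 0"
proof -
  have "(\<Sum>i\<in>UNIV. (c $ i * exp (\<alpha> i \<bullet> x)) *\<^sub>R \<alpha> i) \<bullet> v = 0" "exp_sum \<alpha> c x * (\<alpha> p \<bullet> v) = 0"
    using assms by (simp_all add: Sing_exp_sum_iff)
  then show ?thesis
    by (simp add: exp_sum_def inner_sum_left inner_diff_left right_diff_distrib sum_subtractf
        sum_distrib_right)
qed

text \<open>
  After division by \<open>exp (\<alpha> p \<bullet> y)\<close> the function lies above its tangent plane at \<open>x\<close>, which is
  zero. The tangent line inequality \<open>1 + t \<le> exp t\<close> is applied to each term; at \<open>i = p\<close>,
  where the weight may be negative, it holds with equality.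
\<close>

lemma exp_sum_nonneg_of_Sing:
  assumes pos: "\<And>i. i \<noteq> p \<Longrightarrow> c $ i > 0"
    and sing: "x \<in> Sing (exp_sum \<alpha> c)"
  shows "exp_sum \<alpha> c y \<ge> 0"
proof -
  define z where "z = y - x"
  define w where "w i = c $ i * exp (\<alpha> i \<bullet> x)" for i
  have "0 = (\<Sum>i\<in>UNIV. w i * (1 + (\<alpha> i - \<alpha> p) \<bullet> z))"
    using sing Sing_weighted_diff_sum_zero[OF sing, of p z]
    by (simp add: w_def Sing_exp_sum_iff exp_sum_def distrib_left sum.distrib)
  also have "\<dots> \<le> (\<Sum>i\<in>UNIV. w i * exp ((\<alpha> i - \<alpha> p) \<bullet> z))"
  proof (rule sum_mono)
    fix i
    show "w i * (1 + (\<alpha> i - \<alpha> p) \<bullet> z) \<le> w i * exp ((\<alpha> i - \<alpha> p) \<bullet> z)"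
    proof (cases "i = p")
      case False
      then have "w i \<ge> 0" using pos[of i] by (simp add: w_def)
      then show ?thesis by (intro mult_left_mono exp_ge_add_one_self)
    qed simp
  qed
  finally have "0 \<le> exp (\<alpha> p \<bullet> z) * (\<Sum>i\<in>UNIV. w i * exp ((\<alpha> i - \<alpha> p) \<bullet> z))"
    by simp
  also have "\<dots> = exp_sum \<alpha> c y"
    unfolding exp_sum_def sum_distrib_left w_def z_def
    by (intro sum.cong refl)
       (simp add: exp_add[symmetric] inner_diff_left inner_diff_right algebra_simps)
  finally show ?thesis .
qed

lemma Sing_of_nonneg_zero:
  assumes nonneg: "\<And>y. exp_sum \<alpha> c y \<ge> 0" and zero: "exp_sum \<alpha> c x = 0"
  shows "x \<in> Sing (exp_sum \<alpha> c)"
proof -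
  have "exp_sum \<alpha> (\<chi> i. c $ i * \<alpha> i $ j) x = 0" for j
    by (rule DERIV_local_min[OF exp_sum_line_has_derivative zero_less_one])
       (simp add: nonneg zero)
  then show ?thesis by (simp add: Sing_def partial_deriv_exp_sum zero)
qed

text \<open>
  The gap between the two alternatives is the case of a nonnegative function with a zero; such
  a zero is a minimum and hence singular. Conversely, by convexity, a function with a singular
  point is nonnegative and has a zero, which excludes both alternatives.
\<close>

lemma Sing_empty_iff:
  assumes "\<And>i. i \<noteq> p \<Longrightarrow> c $ i > 0"
  shows "Sing (exp_sum \<alpha> c) = {} \<longleftrightarrow> (\<exists>x. exp_sum \<alpha> c x < 0) \<or> (\<forall>x. exp_sum \<alpha> c x > 0)"
proof
  assume "Sing (exp_sum \<alpha> c) = {}"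
  then show "(\<exists>x. exp_sum \<alpha> c x < 0) \<or> (\<forall>x. exp_sum \<alpha> c x > 0)"
    using Sing_of_nonneg_zero[of \<alpha> c] by (metis empty_iff linorder_neqE_linordered_idom not_le)
next
  assume "(\<exists>x. exp_sum \<alpha> c x < 0) \<or> (\<forall>x. exp_sum \<alpha> c x > 0)"
  moreover have "exp_sum \<alpha> c y \<ge> 0" "exp_sum \<alpha> c x = 0"
    if "x \<in> Sing (exp_sum \<alpha> c)" for x y
    using exp_sum_nonneg_of_Sing[of p c x \<alpha> y] assms that by (simp_all add: Sing_def)
  ultimately show "Sing (exp_sum \<alpha> c) = {}"
    by (metis ex_in_conv less_irrefl not_le)
qed

text \<open>
  Otherwise the support would lie in a hyperplane with normal vector \<open>v\<close>.
\<close>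

lemma full_dimensional_orthogonal_diffs:
  assumes "full_dimensional \<alpha>" and "\<And>i. (\<alpha> i - \<alpha> p) \<bullet> v = 0"
  shows "v = 0"
proof (rule ccontr)
  assume "v \<noteq> 0"
  have "range \<alpha> \<subseteq> {y. v \<bullet> y = v \<bullet> \<alpha> p}"
    using assms(2) by (auto simp: inner_diff_left inner_commute[of v])
  then have "aff_dim (range \<alpha>) \<le> aff_dim {y. v \<bullet> y = v \<bullet> \<alpha> p}"
    by (rule aff_dim_subset)
  with \<open>v \<noteq> 0\<close> assms(1) show False
    by (simp add: full_dimensional_def aff_dim_convex_hull aff_dim_hyperplane)
qed

lemma hessian_positive_definite_at_Sing:
  assumes full: "full_dimensional \<alpha>"
    and pos: "\<And>i. i \<noteq> p \<Longrightarrow> c $ i > 0"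
    and sing: "x \<in> Sing (exp_sum \<alpha> c)" and "v \<noteq> 0"
  shows "v \<bullet> (hessian (exp_sum \<alpha> c) x *v v) > 0"
proof -
  define w where "w i = c $ i * exp (\<alpha> i \<bullet> x)" for i
  have "(\<Sum>i\<in>UNIV. w i) = 0"
    using sing by (simp add: Sing_exp_sum_iff exp_sum_def w_def)
  \<comment> \<open>Expand around \<open>\<alpha> p\<close>; the last two terms sum to zero over \<open>i\<close> at a singular point.\<close>
  have square: "w i * (\<alpha> i \<bullet> v)\<^sup>2 = w i * ((\<alpha> i - \<alpha> p) \<bullet> v)\<^sup>2 +
      (2 * (\<alpha> p \<bullet> v)) * (w i * ((\<alpha> i - \<alpha> p) \<bullet> v)) + (\<alpha> p \<bullet> v)\<^sup>2 * w i" for i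
    by (simp add: inner_diff_left power2_eq_square algebra_simps)
  have "v \<bullet> (hessian (exp_sum \<alpha> c) x *v v) = (\<Sum>i\<in>UNIV. w i * (\<alpha> i \<bullet> v)\<^sup>2)"
    by (simp add: hessian_exp_sum_quadratic_form w_def)
  also have "\<dots> = (\<Sum>i\<in>UNIV. w i * ((\<alpha> i - \<alpha> p) \<bullet> v)\<^sup>2)"
    using Sing_weighted_diff_sum_zero[OF sing, of p v] \<open>(\<Sum>i\<in>UNIV. w i) = 0\<close>
    unfolding square sum.distrib sum_distrib_left[symmetric] by (simp add: w_def)
  also have "\<dots> > 0"
  proof -
    obtain i where i: "(\<alpha> i - \<alpha> p) \<bullet> v \<noteq> 0"
      using full_dimensional_orthogonal_diffs[OF full] \<open>v \<noteq> 0\<close> by blast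
    then have "i \<noteq> p" by auto
    have "w j * ((\<alpha> j - \<alpha> p) \<bullet> v)\<^sup>2 \<ge> 0" for j
      by (cases "j = p") (use pos[of j] in \<open>auto simp: w_def\<close>)
    moreover have "w i * ((\<alpha> i - \<alpha> p) \<bullet> v)\<^sup>2 > 0"
      using i pos[OF \<open>i \<noteq> p\<close>] by (simp add: w_def)
    ultimately show ?thesis by (intro sum_pos2[of _ i]) auto
  qed
  finally show ?thesis .
qed

section \<open>Logarithmic coordinates on an orthant\<close>

text \<open>
  The inverse of \<^const>\<open>Log_abs\<close> on the orthant with signs \<open>\<epsilon>\<close>, so that \<open>u\<close> ranges freely over
  the whole space.
\<close>

definition orthant_exp :: "real ^ 'm \<Rightarrow> real ^ 'm \<Rightarrow> real ^ 'm" where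
  "orthant_exp \<epsilon> u = (\<chi> i. \<epsilon> $ i * exp (u $ i))"

lemma orthant_exp_Log_abs:
  assumes "\<And>i. \<epsilon> $ i \<in> {1, -1}" and "c \<in> sign_orthant \<epsilon>"
  shows "orthant_exp \<epsilon> (Log_abs c) = c"
proof -
  have "\<epsilon> $ i * exp (ln \<bar>c $ i\<bar>) = c $ i" for i
  proof -
    have "sgn (c $ i) = \<epsilon> $ i" using assms(2) by (auto simp: sign_orthant_def)
    moreover from this have "c $ i \<noteq> 0" using assms(1)[of i] by auto
    ultimately show ?thesis by (metis exp_ln sgn_mult_abs zero_less_abs_iff)
  qed
  then show ?thesis by (simp add: orthant_exp_def Log_abs_def vec_eq_iff)
qed

lemma Log_abs_orthant_exp:
  assumes "\<And>i. \<epsilon> $ i \<in> {1, -1}"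
  shows "Log_abs (orthant_exp \<epsilon> u) = u" and "orthant_exp \<epsilon> u \<in> sign_orthant \<epsilon>"
proof -
  have "ln \<bar>\<epsilon> $ i * exp (u $ i)\<bar> = u $ i" "sgn (\<epsilon> $ i * exp (u $ i)) = \<epsilon> $ i" for i
    using assms[of i] by (auto simp: abs_mult sgn_mult)
  then show "Log_abs (orthant_exp \<epsilon> u) = u" "orthant_exp \<epsilon> u \<in> sign_orthant \<epsilon>"
    by (simp_all add: Log_abs_def orthant_exp_def sign_orthant_def vec_eq_iff)
qed

lemma signed_reduced_discriminant_image:
  assumes "\<And>i. \<epsilon> $ i \<in> {1, -1}"
  shows "signed_reduced_discriminant \<alpha> \<epsilon> B =
    (*v) (transpose B) ` {u. Sing (exp_sum \<alpha> (orthant_exp \<epsilon> u)) \<noteq> {}}"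
    (is "?L = ?R")
proof
  show "?L \<subseteq> ?R"
    using orthant_exp_Log_abs[OF assms]
    by (fastforce simp: signed_reduced_discriminant_def signed_discriminant_def)
  show "?R \<subseteq> ?L"
    using Log_abs_orthant_exp[OF assms]
    by (fastforce simp: signed_reduced_discriminant_def signed_discriminant_def)
qed

text \<open>
  Adding to \<open>u\<close> the values of an affine function at the exponents, that is, an element of the row
  space of \<open>A_hat \<alpha>\<close>, multiplies the exponential sum by \<open>exp a\<close> and translates it by \<open>x\<close>.
\<close>

lemma Sing_nonempty_shift:
  assumes "Sing (exp_sum \<alpha> (orthant_exp \<epsilon> u)) \<noteq> {}"
  shows "Sing (exp_sum \<alpha> (orthant_exp \<epsilon> (\<chi> i. u $ i + a + \<alpha> i \<bullet> x))) \<noteq> {}"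
proof -
  obtain z where z: "z \<in> Sing (exp_sum \<alpha> (orthant_exp \<epsilon> u))" using assms by blast
  have coeff: "orthant_exp \<epsilon> (\<chi> i. u $ i + a + \<alpha> i \<bullet> x) $ i * exp (\<alpha> i \<bullet> (z - x)) =
      exp a * (orthant_exp \<epsilon> u $ i * exp (\<alpha> i \<bullet> z))" for i
    by (simp add: orthant_exp_def exp_add[symmetric] inner_diff_right)
  have "z - x \<in> Sing (exp_sum \<alpha> (orthant_exp \<epsilon> (\<chi> i. u $ i + a + \<alpha> i \<bullet> x)))"
    using z unfolding Sing_exp_sum_iff exp_sum_def coeff scaleR_scaleR[symmetric]
      scaleR_right.sum[symmetric] sum_distrib_left[symmetric] by simp
  then show ?thesis by blast
qed

section \<open>The Gale dual as a quotient map\<close>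

lemma gale_dual_transpose_surj:
  fixes B :: "real ^ 'k::finite ^ 'm::finite"
  assumes "gale_dual \<alpha> B"
  shows "surj ((*v) (transpose B))"
proof -
  have "columns B = range (\<lambda>j. column j B)" by (auto simp: columns_def)
  then have "card (columns B) = CARD('k)"
    using assms by (simp add: gale_dual_def card_image)
  then have "rank B = CARD('k)"
    using assms by (simp add: column_rank_def gale_dual_def dim_eq_card_independent)
  then show ?thesis
    unfolding full_rank_surjective[symmetric] by (simp only: rank_transpose)
qed

lemma ker_A_hat_iff:
  "z \<in> ker_A_hat \<alpha> \<longleftrightarrow> (\<Sum>i\<in>UNIV. z $ i) = 0 \<and> (\<forall>j. (\<Sum>i\<in>UNIV. z $ i * \<alpha> i $ j) = 0)"
  by (auto simp: ker_A_hat_def A_hat_def matrix_vector_mult_def vec_eq_iff mult.commute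
      split_option_all)

text \<open>
  The orthogonal complement of the kernel of \<open>A_hat \<alpha>\<close> is its row space. The row space is
  written as the space of value vectors of affine functions at the exponents, which is the form
  in which it acts on exponential sums.
\<close>

lemma affine_values_of_orthogonal_ker:
  fixes \<alpha> :: "'m::finite \<Rightarrow> real ^ 'n::finite"
  assumes orth: "\<And>z. z \<in> ker_A_hat \<alpha> \<Longrightarrow> z \<bullet> w = 0"
  obtains a x where "w = (\<chi> i. a + \<alpha> i \<bullet> x)"
proof -
  define S where "S = range (\<lambda>(a, x). (\<chi> i. a + \<alpha> i \<bullet> x) :: real ^ 'm)"
  have S: "(\<chi> i. a + \<alpha> i \<bullet> x) \<in> S" for a x
    by (auto simp: S_def)
  have "linear (\<lambda>(a, x). (\<chi> i. a + \<alpha> i \<bullet> x) :: real ^ 'm)"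
    by (rule linearI) (auto simp: vec_eq_iff inner_add_right algebra_simps)
  then have "subspace S"
    unfolding S_def using linear_subspace_image subspace_UNIV by blast
  then have span: "span S = S" by (simp add: span_eq_iff)
  obtain y z where y: "y \<in> S" and z: "\<And>s. s \<in> S \<Longrightarrow> orthogonal z s" and w: "w = y + z"
    using orthogonal_subspace_decomp_exists[of S w] unfolding span by blast
  have "z \<in> ker_A_hat \<alpha>"
    unfolding ker_A_hat_iff
  proof (intro conjI allI)
    show "(\<Sum>i\<in>UNIV. z $ i) = 0"
      using z[OF S[of 1 0]] by (simp add: orthogonal_def inner_vec_def)
    show "(\<Sum>i\<in>UNIV. z $ i * \<alpha> i $ j) = 0" for j
      using z[OF S[of 0 "axis j 1"]] unfolding orthogonal_def inner_vec_def[of z]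
      by (simp add: inner_axis)
  qed
  then have "z \<bullet> z = 0"
    using orth[of z] z[OF y] by (simp add: w inner_add_right orthogonal_def)
  with y w show thesis by (auto simp: S_def intro: that)
qed

lemma gale_dual_transpose_fibre:
  assumes gale: "gale_dual \<alpha> B" and eq: "transpose B *v u = transpose B *v v"
  obtains a x where "u = (\<chi> i. v $ i + a + \<alpha> i \<bullet> x)"
proof -
  have "orthogonal (u - v) (column j B)" for j
  proof -
    have "(transpose B *v (u - v)) $ j = 0" using eq by (simp add: vec.diff)
    then show ?thesis
      by (simp add: orthogonal_def matrix_vector_mult_def transpose_def column_def inner_vec_def
          mult.commute)
  qed
  then have "orthogonal (u - v) b" if "b \<in> span (columns B)" for b
    using orthogonal_to_span[OF that] by (auto simp: columns_def)
  then have "z \<bullet> (u - v) = 0" if "z \<in> ker_A_hat \<alpha>" for z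
    using that gale by (simp add: gale_dual_def orthogonal_def inner_commute)
  then obtain a x where "u - v = (\<chi> i. a + \<alpha> i \<bullet> x)"
    by (rule affine_values_of_orthogonal_ker)
  then have "u = (\<chi> i. v $ i + a + \<alpha> i \<bullet> x)"
    by (simp add: vec_eq_iff algebra_simps)
  then show thesis by (rule that)
qed

text \<open>
  The set of \<open>u\<close> with a singular point is a union of fibres of the surjection \<open>B\<^sup>T\<close>, so taking
  complements commutes with taking images.
\<close>

lemma complement_signed_reduced_discriminant:
  assumes "\<And>i. \<epsilon> $ i \<in> {1, -1}" and gale: "gale_dual \<alpha> B"
  shows "- signed_reduced_discriminant \<alpha> \<epsilon> B =
    (*v) (transpose B) ` {u. Sing (exp_sum \<alpha> (orthant_exp \<epsilon> u)) = {}}"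
proof -
  let ?N = "{u. Sing (exp_sum \<alpha> (orthant_exp \<epsilon> u)) \<noteq> {}}"
  have "u \<in> ?N" if v: "v \<in> ?N" and eq: "transpose B *v u = transpose B *v v" for u v
  proof -
    obtain a x where "u = (\<chi> i. v $ i + a + \<alpha> i \<bullet> x)"
      using gale eq by (rule gale_dual_transpose_fibre)
    with v show ?thesis by (simp add: Sing_nonempty_shift)
  qed
  then have "- ((*v) (transpose B) ` ?N) = (*v) (transpose B) ` (- ?N)"
    using gale_dual_transpose_surj[OF gale] by (fastforce simp: surj_def)
  moreover have "- ?N = {u. Sing (exp_sum \<alpha> (orthant_exp \<epsilon> u)) = {}}" by blast
  ultimately show ?thesis
    by (simp add: signed_reduced_discriminant_image[OF assms(1)])
qed

section \<open>The two regions of the complement\<close>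

text \<open>
  Dividing by the negative term turns \<open>f < 0\<close> into \<open>g u x < 1\<close>, where \<open>g\<close> is a sum of
  exponentials of linear functions of \<open>(u, x)\<close>. Convexity of \<open>g\<close> in both variables together
  survives the projection that forgets \<open>x\<close>.
\<close>

lemma convex_negative_somewhere:
  fixes \<alpha> :: "'m::finite \<Rightarrow> real ^ 'n::finite" and \<epsilon> :: "real ^ 'm"
  assumes \<epsilon>: "\<And>i. \<epsilon> $ i = (if i = p then -1 else 1)"
  shows "convex {u. \<exists>x. exp_sum \<alpha> (orthant_exp \<epsilon> u) x < 0}"
proof -
  define g where "g u x = (\<Sum>i\<in>UNIV - {p}. exp (u $ i - u $ p + (\<alpha> i - \<alpha> p) \<bullet> x))" for u :: "real ^ 'm" and x
  have negative_iff: "exp_sum \<alpha> (orthant_exp \<epsilon> u) x < 0 \<longleftrightarrow> g u x < 1" for u x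
  proof -
    have "exp_sum \<alpha> (orthant_exp \<epsilon> u) x =
        - exp (u $ p + \<alpha> p \<bullet> x) + (\<Sum>i\<in>UNIV - {p}. exp (u $ i + \<alpha> i \<bullet> x))"
      unfolding exp_sum_def by (subst sum.remove[of _ p]) (auto simp: orthant_exp_def \<epsilon> exp_add)
    also have "(\<Sum>i\<in>UNIV - {p}. exp (u $ i + \<alpha> i \<bullet> x)) = exp (u $ p + \<alpha> p \<bullet> x) * g u x"
      by (simp add: g_def sum_distrib_left exp_add[symmetric] inner_diff_left)
    finally have "exp_sum \<alpha> (orthant_exp \<epsilon> u) x = exp (u $ p + \<alpha> p \<bullet> x) * (g u x - 1)"
      by (simp add: algebra_simps)
    then show ?thesis by (simp add: mult_less_0_iff)
  qed
  show ?thesis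
    unfolding negative_iff
  proof (rule convexI)
    fix u v :: "real ^ 'm" and s t :: real
    assume "u \<in> {u. \<exists>x. g u x < 1}" "v \<in> {u. \<exists>x. g u x < 1}"
      and st: "0 \<le> s" "0 \<le> t" "s + t = 1"
    then obtain x y where xy: "g u x < 1" "g v y < 1" by auto
    have "g (s *\<^sub>R u + t *\<^sub>R v) (s *\<^sub>R x + t *\<^sub>R y) \<le> s * g u x + t * g v y"
      unfolding g_def sum_distrib_left sum.distrib[symmetric]
    proof (rule sum_mono)
      fix i
      let ?a = "u $ i - u $ p + (\<alpha> i - \<alpha> p) \<bullet> x" and ?b = "v $ i - v $ p + (\<alpha> i - \<alpha> p) \<bullet> y"
      have "exp (s *\<^sub>R ?a + t *\<^sub>R ?b) \<le> s * exp ?a + t * exp ?b"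
        using exp_convex st by (auto simp: convex_on_def)
      then show "exp ((s *\<^sub>R u + t *\<^sub>R v) $ i - (s *\<^sub>R u + t *\<^sub>R v) $ p +
          (\<alpha> i - \<alpha> p) \<bullet> (s *\<^sub>R x + t *\<^sub>R y)) \<le> s * exp ?a + t * exp ?b"
        by (simp add: inner_add_right algebra_simps)
    qed
    also have "\<dots> < 1"
      using convex_bound_lt[OF xy st] .
    finally show "s *\<^sub>R u + t *\<^sub>R v \<in> {u. \<exists>x. g u x < 1}" by blast
  qed
qed

text \<open>
  Positivity is preserved when coefficients increase, and in logarithmic coordinates this means
  that \<open>\<epsilon> $ i * u $ i\<close> increases for each \<open>i\<close>. Any two points have a common upper bound in
  this order, and the points above a given one form a convex set.
\<close>

lemma connected_positive_everywhere:
  fixes \<alpha> :: "'m::finite \<Rightarrow> real ^ 'n::finite" and \<epsilon> :: "real ^ 'm"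
  assumes \<epsilon>: "\<And>i. \<epsilon> $ i \<in> {1, -1}"
  shows "connected {u. \<forall>x. exp_sum \<alpha> (orthant_exp \<epsilon> u) x > 0}" (is "connected ?D")
proof -
  define up where "up u = {z. \<forall>i. \<epsilon> $ i * u $ i \<le> \<epsilon> $ i * z $ i}" for u :: "real ^ 'm"
  have "connected (up u)" for u
  proof (rule convex_connected, rule convexI)
    fix y z and s t :: real
    assume yz: "y \<in> up u" "z \<in> up u" and st: "0 \<le> s" "0 \<le> t" "s + t = 1"
    have "\<epsilon> $ i * u $ i \<le> s * (\<epsilon> $ i * y $ i) + t * (\<epsilon> $ i * z $ i)" for i
      using convex_bound_le[of "- (\<epsilon> $ i * y $ i)" "- (\<epsilon> $ i * u $ i)" "- (\<epsilon> $ i * z $ i)" s t]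
        yz st by (simp add: up_def)
    then show "s *\<^sub>R y + t *\<^sub>R z \<in> up u"
      by (simp add: up_def algebra_simps)
  qed
  moreover have "up u \<subseteq> ?D" if "u \<in> ?D" for u
  proof
    fix z assume z: "z \<in> up u"
    have "orthant_exp \<epsilon> u $ i \<le> orthant_exp \<epsilon> z $ i" for i
      using z \<epsilon>[of i] by (auto simp: up_def orthant_exp_def dest: spec[of _ i])
    then have "exp_sum \<alpha> (orthant_exp \<epsilon> u) x \<le> exp_sum \<alpha> (orthant_exp \<epsilon> z) x" for x
      unfolding exp_sum_def by (intro sum_mono mult_right_mono) auto
    with that show "z \<in> ?D" by (auto intro: less_le_trans)
  qed
  ultimately have reach: "connected_component ?D u z" if "u \<in> ?D" "z \<in> up u" for u z
    using that unfolding connected_component_def by (intro exI[of _ "up u"]) (auto simp: up_def)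
  show ?thesis
    unfolding connected_iff_connected_component
  proof (intro ballI)
    fix u v assume uv: "u \<in> ?D" "v \<in> ?D"
    \<comment> \<open>The join of \<open>u\<close> and \<open>v\<close> in this order; the outer factor uses \<open>\<epsilon> $ i * \<epsilon> $ i = 1\<close>.\<close>
    define w where "w = (\<chi> i. \<epsilon> $ i * max (\<epsilon> $ i * u $ i) (\<epsilon> $ i * v $ i))"
    have "\<epsilon> $ i * w $ i = max (\<epsilon> $ i * u $ i) (\<epsilon> $ i * v $ i)" for i
      using \<epsilon>[of i] by (auto simp: w_def)
    then have "w \<in> up u" "w \<in> up v" by (simp_all add: up_def)
    then show "connected_component ?D u v"
      using reach uv by (meson connected_component_sym connected_component_trans)
  qed
qed

section \<open>Counting components\<close>

lemma components_Un_connected: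
  assumes "connected T" and "connected U"
  shows "finite (components (T \<union> U)) \<and> card (components (T \<union> U)) \<le> 2"
proof -
  obtain t where t: "T \<subseteq> connected_component_set (T \<union> U) t"
    using connected_component_maximal[of _ T "T \<union> U"] assms(1)
    by (metis Un_upper1 empty_subsetI ex_in_conv)
  obtain u where u: "U \<subseteq> connected_component_set (T \<union> U) u"
    using connected_component_maximal[of _ U "T \<union> U"] assms(2)
    by (metis Un_upper2 empty_subsetI ex_in_conv)
  define K where "K = {connected_component_set (T \<union> U) t, connected_component_set (T \<union> U) u}"
  have "C \<in> K" if "C \<in> components (T \<union> U)" for C
  proof -
    from that obtain x where "x \<in> T \<union> U" and C: "C = connected_component_set (T \<union> U) x"
      by (auto simp: components_def)
    then have "x \<in> connected_component_set (T \<union> U) t \<or> x \<in> connected_component_set (T \<union> U) u"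
      using t u by blast
    then show ?thesis
      unfolding C K_def using connected_component_eq[of x "T \<union> U"] by blast
  qed
  then have "components (T \<union> U) \<subseteq> K" by blast
  moreover have "finite K" "card K \<le> 2"
    by (simp_all add: K_def card_insert_if)
  ultimately show ?thesis
    using card_mono finite_subset le_trans by metis
qed

theorem theorem4p12:
  fixes \<alpha> :: "'m::finite \<Rightarrow> real ^ 'n::finite" and \<epsilon> :: "real ^ 'm"
  assumes "signed_support \<alpha> \<epsilon>"
    and "full_dimensional \<alpha>"
    and "card (neg_support \<alpha> \<epsilon>) = 1"
  shows "(\<forall>c\<in>sign_orthant \<epsilon>. \<forall>x\<in>Sing (exp_sum \<alpha> c).
            \<forall>\<mu>. eigenvalue (hessian (exp_sum \<alpha> c) x) \<mu> \<longrightarrow> \<mu> > 0)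
       \<and> (codimension \<alpha> = 2 \<longrightarrow>
            (\<forall>B :: real ^ 2 ^ 'm. gale_dual \<alpha> B \<longrightarrow>
               finite (components (- signed_reduced_discriminant \<alpha> \<epsilon> B)) \<and>
               card (components (- signed_reduced_discriminant \<alpha> \<epsilon> B)) \<le> 2))"
proof -
  have \<epsilon>: "\<epsilon> $ i \<in> {1, -1}" for i
    using assms(1) by (simp add: signed_support_def)
  have "neg_support \<alpha> \<epsilon> = \<alpha> ` {i. \<epsilon> $ i = -1}"
    by (auto simp: neg_support_def)
  then have "card {i. \<epsilon> $ i = -1} = 1"
    using assms(1,3) by (metis card_image inj_on_subset signed_support_def subset_UNIV)
  then obtain p where p: "{i. \<epsilon> $ i = -1} = {p}"
    by (rule card_1_singletonE)
  have \<epsilon>_p: "\<epsilon> $ i = (if i = p then -1 else 1)" for i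
    using p \<epsilon>[of i] by auto
  have pos: "c $ i > 0" if "c \<in> sign_orthant \<epsilon>" "i \<noteq> p" for c i
    using that \<epsilon>_p[of i] by (auto simp: sign_orthant_def dest!: spec[of _ i] simp: sgn_1_pos)
  have hessian: "\<mu> > 0"
    if c: "c \<in> sign_orthant \<epsilon>" and x: "x \<in> Sing (exp_sum \<alpha> c)"
      and ev: "eigenvalue (hessian (exp_sum \<alpha> c) x) \<mu>" for c x \<mu>
  proof -
    from ev obtain v where v: "v \<noteq> 0" "hessian (exp_sum \<alpha> c) x *v v = \<mu> *\<^sub>R v"
      by (auto simp: eigenvalue_def)
    have "v \<bullet> (hessian (exp_sum \<alpha> c) x *v v) > 0"
      using assms(2) pos[OF c] x v(1) by (rule hessian_positive_definite_at_Sing)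
    then have "\<mu> * (v \<bullet> v) > 0"
      by (simp add: v(2))
    then show "\<mu> > 0"
      by (rule zero_less_mult_pos2) (use v(1) in simp)
  qed
  have components: "finite (components (- signed_reduced_discriminant \<alpha> \<epsilon> B)) \<and>
      card (components (- signed_reduced_discriminant \<alpha> \<epsilon> B)) \<le> 2"
    if gale: "gale_dual \<alpha> B" for B :: "real ^ 2 ^ 'm"
  proof -
    let ?f = "\<lambda>u. exp_sum \<alpha> (orthant_exp \<epsilon> u)"
    let ?P = "{u. \<exists>x. ?f u x < 0}" and ?D = "{u. \<forall>x. ?f u x > 0}"
    have "{u. Sing (?f u) = {}} = ?P \<union> ?D"
      using Sing_empty_iff[OF pos[OF Log_abs_orthant_exp(2)[OF \<epsilon>]]] by blast
    then have eq: "- signed_reduced_discriminant \<alpha> \<epsilon> B =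
        (*v) (transpose B) ` ?P \<union> (*v) (transpose B) ` ?D"
      by (simp add: complement_signed_reduced_discriminant[OF \<epsilon> gale] image_Un
          del: transpose_matrix_vector)
    have connected: "connected ((*v) (transpose B) ` ?P)" "connected ((*v) (transpose B) ` ?D)"
      using convex_connected[OF convex_negative_somewhere[OF \<epsilon>_p, of \<alpha>]]
        connected_positive_everywhere[OF \<epsilon>, of \<alpha>]
      by (auto intro!: connected_continuous_image linear_continuous_on
          matrix_vector_mul_bounded_linear simp del: transpose_matrix_vector)
    show ?thesis
      unfolding eq using connected by (rule components_Un_connected)
  qed
  show ?thesis
    using hessian components by blast
qed

end
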